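(* Let $\alpha,\beta$ be partitions with $|\alpha|=|\beta|$. Suppose that there does not exist a partition $\mu$ such that $\alpha=\mu_{(1)}$ and $\beta=(\mu')_{(1)}$. Then there exists a sign-reversing involution on $X_{\alpha,\beta,1}$, i.e. a map $\varphi\colon X_{\alpha,\beta,1}\to X_{\alpha,\beta,1}$ with $\varphi\circ\varphi=\mathrm{id}$ and $\operatorname{sgn}(\varphi(\chi))=-\operatorname{sgn}(\chi)$ for all $\chi\in X_{\alpha,\beta,1}$.
   Context: Partitions are identified with their Young diagrams (English notation; box $(i,j)$ is in row $i$, column $j$). $\mu'$ is the conjugate (transpose) of $\mu$, $\ell(\mu)$ its number of nonzero rows, $|\mu|$ its size, and $\emptyset$ the empty partition. The rank $r(\mu)$ is the greatest integer $k\ge 0$ with $\mu_k\ge k$ (side length of the Durfee square; $r(\emptyset)=0$). The $k$-stabilization $\mu_{(k)}$ is the partition obtained from $\mu$ by adding $k$ rows of length $r(\mu)$ (inserted so that the rows remain weakly decreasing). For partitions $\nu\subseteq\alpha$, a tableau of skew shape $\alpha/\nu$ is a filling of the boxes of $\alpha$ not in $\nu$ with positive integers; it is semistandard if rows weakly increase left to right and columns strictly increase top to bottom. Its content is $(c_1,c_2,\dots)$ with $c_i$ the number of labels equal to $i$. Its reverse reading word is obtained by reading the rows right to left, from top to bottom. A word is lattice if for every $i\ge1$ each initial segment contains at least as many $i$'s as $(i+1)$'s. A Littlewood--Richardson tableau is a semistandard tableau whose reverse reading word is lattice. $\mathrm{LR}(\alpha/\nu,\lambda)$ denotes the set of Littlewood--Richardson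 tableaux of shape $\alpha/\nu$ and content $\lambda$ (empty if $\nu\not\subseteq\alpha$). For partitions $\alpha,\beta$ with $|\alpha|=|\beta|$ and $k\ge0$, define $$X_{\alpha,\beta}(\lambda,\nu)=\mathrm{LR}(\alpha/\nu,\lambda)\times\mathrm{LR}(\beta/\nu',\lambda),\qquad X_{\alpha,\beta,k}=\bigsqcup_{\lambda,\nu:\ \ell(\lambda)\le k}X_{\alpha,\beta}(\lambda,\nu),$$ where $\lambda,\nu$ range over partitions. The sign of $\chi\in X_{\alpha,\beta}(\lambda,\nu)$ is $\operatorname{sgn}(\chi)=(-1)^{|\nu|}$. *)

theory Defs
  imports Main "HOL-Library.FuncSet"
begin

text \<open>A partition is the list of its nonzero parts; rows and columns of a Young diagram are
  numbered from 1.\<close>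

definition is_partition :: "nat list \<Rightarrow> bool" where
  "is_partition \<mu> \<longleftrightarrow> sorted_wrt (\<ge>) \<mu> \<and> 0 \<notin> set \<mu>"

definition part :: "nat list \<Rightarrow> nat \<Rightarrow> nat" where
  "part \<mu> i = (if 1 \<le> i \<and> i \<le> length \<mu> then \<mu> ! (i - 1) else 0)"

definition young_diagram :: "nat list \<Rightarrow> (nat \<times> nat) set" where
  "young_diagram \<mu> = {(i, j). 1 \<le> i \<and> 1 \<le> j \<and> j \<le> part \<mu> i}"

definition conj_part :: "nat list \<Rightarrow> nat list" where
  "conj_part \<mu> = map (\<lambda>j. length (filter (\<lambda>x. j \<le> x) \<mu>)) [1..<part \<mu> 1 + 1]"

text \<open>The value 0 always satisfies the condition below, so the greatest element exists.\<close>

definition durfee_rank :: "nat list \<Rightarrow> nat" where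
  "durfee_rank \<mu> = (GREATEST k. k \<le> part \<mu> k)"

text \<open>The filter only matters for the empty partition: it has rank 0, and adding rows of
  length 0 does not change it.\<close>

definition stabilization :: "nat \<Rightarrow> nat list \<Rightarrow> nat list" where
  "stabilization k \<mu> =
     filter (\<lambda>x. 0 < x) (rev (sort (\<mu> @ replicate k (durfee_rank \<mu>))))"

definition skew_shape :: "nat list \<Rightarrow> nat list \<Rightarrow> (nat \<times> nat) set" where
  "skew_shape \<alpha> \<nu> = young_diagram \<alpha> - young_diagram \<nu>"

text \<open>Tableaux are extensional functions (\<open>undefined\<close> outside the shape), so that distinct
  elements correspond to distinct fillings.\<close>

definition skew_tableaux :: "nat list \<Rightarrow> nat list \<Rightarrow> (nat \<times> nat \<Rightarrow> nat) set" where
  "skew_tableaux \<alpha> \<nu> = skew_shape \<alpha> \<nu> \<rightarrow>\<^sub>E {1..}"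

definition semistandard :: "nat list \<Rightarrow> nat list \<Rightarrow> (nat \<times> nat \<Rightarrow> nat) \<Rightarrow> bool" where
  "semistandard \<alpha> \<nu> T \<longleftrightarrow>
     (\<forall>i j j'. (i, j) \<in> skew_shape \<alpha> \<nu> \<and> (i, j') \<in> skew_shape \<alpha> \<nu> \<and> j < j'
        \<longrightarrow> T (i, j) \<le> T (i, j')) \<and>
     (\<forall>i i' j. (i, j) \<in> skew_shape \<alpha> \<nu> \<and> (i', j) \<in> skew_shape \<alpha> \<nu> \<and> i < i'
        \<longrightarrow> T (i, j) < T (i', j))"

definition has_content :: "nat list \<Rightarrow> nat list \<Rightarrow> (nat \<times> nat \<Rightarrow> nat) \<Rightarrow> nat list \<Rightarrow> bool" where
  "has_content \<alpha> \<nu> T lam \<longleftrightarrow> (\<forall>c\<ge>1. card {b \<in> skew_shape \<alpha> \<nu>. T b = c} = part lam c)"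

definition reverse_reading_word ::
    "nat list \<Rightarrow> nat list \<Rightarrow> (nat \<times> nat \<Rightarrow> nat) \<Rightarrow> nat list" where
  "reverse_reading_word \<alpha> \<nu> T =
     concat (map (\<lambda>i. map (\<lambda>j. T (i, j)) (rev [part \<nu> i + 1..<part \<alpha> i + 1]))
                 [1..<length \<alpha> + 1])"

definition lattice_word :: "nat list \<Rightarrow> bool" where
  "lattice_word w \<longleftrightarrow>
     (\<forall>i\<ge>1. \<forall>n\<le>length w. count_list (take n w) (i + 1) \<le> count_list (take n w) i)"

definition LR :: "nat list \<Rightarrow> nat list \<Rightarrow> nat list \<Rightarrow> (nat \<times> nat \<Rightarrow> nat) set" where
  "LR \<alpha> \<nu> lam =
     {T. young_diagram \<nu> \<subseteq> young_diagram \<alpha> \<and> T \<in> skew_tableaux \<alpha> \<nu> \<and> semistandard \<alpha> \<nu> T \<and>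
         lattice_word (reverse_reading_word \<alpha> \<nu> T) \<and> has_content \<alpha> \<nu> T lam}"

type_synonym LR_pair = "(nat \<times> nat \<Rightarrow> nat) \<times> (nat \<times> nat \<Rightarrow> nat)"

definition X_pairs :: "nat list \<Rightarrow> nat list \<Rightarrow> nat list \<Rightarrow> nat list \<Rightarrow> LR_pair set" where
  "X_pairs \<alpha> \<beta> lam \<nu> = LR \<alpha> \<nu> lam \<times> LR \<beta> (conj_part \<nu>) lam"

text \<open>The disjoint union over \<open>(\<lambda>, \<nu>)\<close> is realised by tagging each pair with its index.\<close>

definition X_union ::
    "nat list \<Rightarrow> nat list \<Rightarrow> nat \<Rightarrow> ((nat list \<times> nat list) \<times> LR_pair) set" where
  "X_union \<alpha> \<beta> k =
     (SIGMA (lam, \<nu>) : {(lam, \<nu>). is_partition lam \<and> is_partition \<nu> \<and> length lam \<le> k}.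
        X_pairs \<alpha> \<beta> lam \<nu>)"

definition X_sign :: "(nat list \<times> nat list) \<times> LR_pair \<Rightarrow> int" where
  "X_sign \<chi> = (case \<chi> of ((lam, \<nu>), _) \<Rightarrow> (-1) ^ sum_list \<nu>)"

end

theory Submission imports Defs "HOL-Library.Multiset" begin

text \<open>A Littlewood--Richardson tableau whose content has at most one row has only entries 1, so
  \<open>X_union \<alpha> \<beta> 1\<close> amounts to the set of partitions \<open>\<nu>\<close> such that \<open>\<alpha>/\<nu>\<close> is a horizontal strip and
  \<open>\<gamma>/\<nu>\<close> is a vertical strip, where \<open>\<gamma>\<close> is the conjugate of \<open>\<beta>\<close>. This says
  \<open>max \<alpha>\<^bsub>i+1\<^esub> (\<gamma>\<^sub>i - 1) \<le> \<nu>\<^sub>i \<le> min \<alpha>\<^sub>i \<gamma>\<^sub>i\<close> for all \<open>i\<close>, and these conditions on the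
  rows are independent of each other, each leaving at most two consecutive values. If some row has
  two values, exchanging them is a sign-reversing involution. If there is exactly one \<open>\<nu>\<close>, then
  \<open>\<gamma>\<^sub>i \<in> {\<alpha>\<^sub>i + 1, \<alpha>\<^bsub>i+1\<^esub>}\<close> for every row; by monotonicity the first alternative holds exactly in
  the rows \<open>i \<le> r\<close> for some \<open>r\<close>, and comparing sizes yields \<open>\<alpha>\<^bsub>r+1\<^esub> = r\<close>. Removing that row
  from \<open>\<alpha>\<close> gives the excluded \<open>\<mu>\<close>.\<close>

section \<open>Partitions as part functions\<close>

lemma part_0 [simp]: "part \<mu> 0 = 0"
  by (simp add: Defs.part_def)

lemma part_Nil [simp]: "part [] i = 0"
  by (simp add: Defs.part_def)

lemma part_Cons: "part (x # xs) i = (if i = 1 then x else part xs (i - 1))"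
  by (cases i; cases "i - 1") (auto simp: Defs.part_def)

lemma part_Suc: "part \<mu> (Suc i) = (if i < length \<mu> then \<mu> ! i else 0)"
  by (auto simp: Defs.part_def)

lemma part_eq_0: "length \<mu> < i \<Longrightarrow> part \<mu> i = 0"
  by (simp add: Defs.part_def)

lemma part_pos_iff:
  assumes "is_partition \<mu>"
  shows "0 < part \<mu> i \<longleftrightarrow> 1 \<le> i \<and> i \<le> length \<mu>"
proof (cases "1 \<le> i \<and> i \<le> length \<mu>")
  case True
  then have "\<mu> ! (i - 1) \<in> set \<mu>"
    by (intro nth_mem) auto
  then have "\<mu> ! (i - 1) \<noteq> 0"
    using assms unfolding is_partition_def by metis
  then show ?thesis
    using True by (simp add: Defs.part_def)
qed (auto simp: Defs.part_def)

text \<open>Row 0 has to be excluded: \<open>part\<close> takes the default value 0 there.\<close>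

lemma part_antimono:
  assumes "is_partition \<mu>" "1 \<le> i" "i \<le> j"
  shows "part \<mu> j \<le> part \<mu> i"
proof (cases "i = j \<or> length \<mu> < j")
  case False
  then have "\<mu> ! (j - 1) \<le> \<mu> ! (i - 1)"
    using assms unfolding is_partition_def by (intro sorted_wrt_nth_less[of "(\<ge>)"]) auto
  then show ?thesis
    using False assms by (auto simp: Defs.part_def)
qed (use assms in \<open>auto simp: part_eq_0\<close>)

text \<open>Zero parts are excluded, so the rows with a positive part determine the length of the
  list as well as its entries.\<close>

lemma partition_eqI:
  assumes "is_partition \<mu>" "is_partition \<nu>"
    and eq: "\<And>i. 1 \<le> i \<Longrightarrow> part \<mu> i = part \<nu> i"
  shows "\<mu> = \<nu>"
proof (rule nth_equalityI)
  have "\<And>i. 1 \<le> i \<Longrightarrow> i \<le> length \<mu> \<longleftrightarrow> i \<le> length \<nu>"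
    using part_pos_iff[OF assms(1)] part_pos_iff[OF assms(2)] eq by metis
  from this[of "length \<mu>"] this[of "length \<nu>"] show len: "length \<mu> = length \<nu>"
    by (cases "length \<mu> = 0"; cases "length \<nu> = 0") auto
  show "\<mu> ! i = \<nu> ! i" if "i < length \<mu>" for i
    using eq[of "Suc i"] that len by (simp add: part_Suc)
qed

text \<open>The bound \<open>n\<close> is lowered until \<open>f n\<close> is positive or
  \<open>n\<close> is 0; then the first \<open>n\<close> values contain no zero and form the
  required list. New partitions are later built from their part functions in this way.\<close>

lemma ex_partition_part:
  assumes "\<And>i j. 1 \<le> i \<Longrightarrow> i \<le> j \<Longrightarrow> f j \<le> (f i :: nat)"
    and "\<And>i. n < i \<Longrightarrow> f i = 0"
  shows "\<exists>\<nu>. is_partition \<nu> \<and> (\<forall>i\<ge>1. part \<nu> i = f i)"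
  using assms(2)
proof (induction n)
  case 0
  then show ?case
    by (intro exI[of _ "[]"]) (auto simp: is_partition_def)
next
  case (Suc n)
  show ?case
  proof (cases "f (Suc n) = 0")
    case True
    have "f i = 0" if "n < i" for i
      using Suc.prems[of i] True that by (cases "i = Suc n") auto
    then show ?thesis
      by (rule Suc.IH)
  next
    case False
    let ?\<nu> = "map f [1..<Suc (Suc n)]"
    have "f (Suc n) \<le> f i" if "1 \<le> i" "i \<le> Suc n" for i
      using assms(1) that by blast
    then have "0 \<notin> set ?\<nu>"
      using False by fastforce
    moreover have "sorted_wrt (\<ge>) ?\<nu>"
      unfolding sorted_wrt_iff_nth_less by (auto intro!: assms(1) simp del: upt_Suc)
    moreover have "part ?\<nu> i = f i" if "1 \<le> i" for i
      using that Suc.prems[of i] by (auto simp: Defs.part_def simp del: upt_Suc)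
    ultimately show ?thesis
      unfolding is_partition_def by blast
  qed
qed

section \<open>Size as a sum over rows and as a number of boxes\<close>

lemma sum_part:
  assumes "length \<mu> \<le> N"
  shows "(\<Sum>i=1..N. part \<mu> i) = sum_list \<mu>"
proof -
  have "(\<Sum>i=1..N. part \<mu> i) = (\<Sum>i=1..length \<mu>. part \<mu> i)"
    using assms by (intro sum.mono_neutral_right) (auto simp: part_eq_0)
  also have "\<dots> = (\<Sum>i<length \<mu>. part \<mu> (Suc i))"
    by (simp add: sum.atLeast1_atMost_eq)
  also have "\<dots> = (\<Sum>i<length \<mu>. \<mu> ! i)"
    by (intro sum.cong) (auto simp: part_Suc)
  finally show ?thesis
    by (simp add: sum_list_sum_nth atLeast0LessThan)
qed

lemma young_diagram_Sigma: "young_diagram \<mu> = (SIGMA i:{1..length \<mu>}. {1..part \<mu> i})"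
  by (auto simp: young_diagram_def Defs.part_def split: if_splits)

lemma finite_young_diagram: "finite (young_diagram \<mu>)"
  by (simp add: young_diagram_Sigma)

lemma card_young_diagram: "card (young_diagram \<mu>) = sum_list \<mu>"
  using sum_part[of \<mu> "length \<mu>"] by (simp add: young_diagram_Sigma)

section \<open>Conjugation\<close>

text \<open>Parts of a conjugate are accessible through positive lower bounds only, so equality with
  such a part is derived from them.\<close>

lemma nat_eqI_lower_bounds:
  fixes a b :: nat
  assumes "\<And>i. 1 \<le> i \<Longrightarrow> i \<le> a \<longleftrightarrow> i \<le> b"
  shows "a = b"
  using assms[of a] assms[of b] by (cases "a = 0"; cases "b = 0") auto

text \<open>The parts decrease weakly, so those of size at least \<open>j\<close> form an initial
  segment; in the induction, a first part below \<open>j\<close> leaves nothing to count.\<close>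

lemma le_length_filter_iff:
  assumes "is_partition \<mu>" "1 \<le> i" "1 \<le> j"
  shows "i \<le> length (filter (\<lambda>x. j \<le> x) \<mu>) \<longleftrightarrow> j \<le> part \<mu> i"
  using assms(1,2)
proof (induction \<mu> arbitrary: i)
  case Nil
  then show ?case using assms(3) by auto
next
  case (Cons x xs)
  have xs: "is_partition xs" and le: "\<And>y. y \<in> set xs \<Longrightarrow> y \<le> x"
    using Cons.prems by (auto simp: is_partition_def)
  show ?case
  proof (cases "j \<le> x")
    case True
    show ?thesis
    proof (cases "i = 1")
      case False
      then have "i - 1 \<le> length (filter (\<lambda>x. j \<le> x) xs) \<longleftrightarrow> j \<le> part xs (i - 1)"
        using Cons.prems by (intro Cons.IH xs) auto
      then show ?thesis
        using True False Cons.prems by (auto simp: part_Cons)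
    qed (use True in \<open>auto simp: part_Cons\<close>)
  next
    case False
    then have empty: "filter (\<lambda>x. j \<le> x) (x # xs) = []"
      using le by (fastforce simp: filter_empty_conv)
    have "part (x # xs) i \<le> x"
      using part_antimono[OF Cons.prems(1), of 1 i] Cons.prems by (simp add: part_Cons)
    then show ?thesis
      unfolding empty using False Cons.prems by simp
  qed
qed

text \<open>The list \<open>conj_part \<mu>\<close> stops at column \<open>part \<mu> 1\<close>;
  beyond it the count is 0, in agreement with the default value of \<open>part\<close>.\<close>

lemma part_conj_part:
  assumes "is_partition \<mu>" "1 \<le> j"
  shows "part (conj_part \<mu>) j = length (filter (\<lambda>x. j \<le> x) \<mu>)"
proof (cases "j \<le> part \<mu> 1")
  case True
  then show ?thesis
    using assms(2) by (cases j) (simp_all add: conj_part_def part_Suc del: upt_Suc)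
next
  case False
  then have "length (filter (\<lambda>x. j \<le> x) \<mu>) = 0"
    using le_length_filter_iff[OF assms(1) order_refl assms(2)] by linarith
  moreover have "part (conj_part \<mu>) j = 0"
    using False by (intro part_eq_0) (simp add: conj_part_def)
  ultimately show ?thesis
    by simp
qed

text \<open>Both sides say that box (i, j) lies in the diagram of \<mu>. Later comparisons of parts
  with parts of conjugates rest on this.\<close>

lemma le_part_conj_part_iff:
  assumes "is_partition \<mu>" "1 \<le> i" "1 \<le> j"
  shows "i \<le> part (conj_part \<mu>) j \<longleftrightarrow> j \<le> part \<mu> i"
  using assms by (simp add: part_conj_part le_length_filter_iff)

lemma is_partition_conj_part:
  assumes "is_partition \<mu>"
  shows "is_partition (conj_part \<mu>)"
proof -
  have len: "length (filter (\<lambda>x. j \<le> x) \<mu>) \<le> length (filter (\<lambda>x. i \<le> x) \<mu>)" if "i \<le> j" for i j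
    using that by (induction \<mu>) auto
  have "sorted_wrt (\<ge>) (conj_part \<mu>)"
    unfolding conj_part_def sorted_wrt_iff_nth_less by (auto intro!: len simp del: upt_Suc)
  moreover have "1 \<le> length (filter (\<lambda>x. j \<le> x) \<mu>)" if "1 \<le> j" "j \<le> part \<mu> 1" for j
    using le_length_filter_iff[OF assms order_refl that(1)] that(2) by simp
  then have "0 \<notin> set (conj_part \<mu>)"
    unfolding conj_part_def by (fastforce simp del: upt_Suc)
  ultimately show ?thesis
    by (simp add: is_partition_def)
qed

lemma sum_list_conj_part:
  assumes "is_partition \<mu>"
  shows "sum_list (conj_part \<mu>) = sum_list \<mu>"
proof -
  have "young_diagram (conj_part \<mu>) = prod.swap ` young_diagram \<mu>"
    using le_part_conj_part_iff[OF assms]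
    by (force simp: young_diagram_def image_iff)
  then have "card (young_diagram (conj_part \<mu>)) = card (young_diagram \<mu>)"
    by (simp add: card_image)
  then show ?thesis
    by (simp add: card_young_diagram)
qed

section \<open>Stabilization\<close>

text \<open>A row k > r cannot reach length k, since its part is at most
  \<open>part \<mu> (Suc r)\<close>, hence at most r. For r = 0 the first bound is trivial.\<close>

lemma durfee_rank_eqI:
  assumes "is_partition \<mu>" "r \<le> part \<mu> r" "part \<mu> (Suc r) \<le> r"
  shows "durfee_rank \<mu> = r"
  unfolding durfee_rank_def
proof (rule Greatest_equality)
  fix k assume k: "k \<le> part \<mu> k"
  show "k \<le> r"
  proof (rule ccontr)
    assume "\<not> k \<le> r"
    then have "part \<mu> k \<le> part \<mu> (Suc r)"
      using assms by (intro part_antimono) auto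
    then show False
      using k \<open>\<not> k \<le> r\<close> assms by linarith
  qed
qed (fact assms)

text \<open>The first r rows have length at least r and the others at most r, so the sorting in
  \<open>stabilization\<close> places the new row of length r as row r + 1.\<close>

lemma stabilization_1_eqI:
  assumes \<alpha>: "is_partition \<alpha>" and \<mu>: "is_partition \<mu>"
    and r: "r \<le> part \<mu> r" "part \<mu> (Suc r) \<le> r"
    and part: "\<And>i. 1 \<le> i \<Longrightarrow>
      part \<alpha> i = (if i \<le> r then part \<mu> i else if i = Suc r then r else part \<mu> (i - 1))"
  shows "\<alpha> = stabilization 1 \<mu>"
proof -
  note rank = durfee_rank_eqI[OF \<mu> r]
  show ?thesis
  proof (cases "r = 0")
    \<comment> \<open>Rank 0 forces both partitions to be empty, and the added row of length 0 is
      filtered out.\<close>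
    case True
    have "\<not> 1 \<le> length \<mu>"
      using r True part_pos_iff[OF \<mu>, of 1] by simp
    moreover have "\<not> 1 \<le> length \<alpha>"
      using part[of 1] True part_pos_iff[OF \<alpha>, of 1] by simp
    ultimately have "\<mu> = []" "\<alpha> = []"
      by (simp_all add: not_less_eq_eq)
    then show ?thesis
      using rank True by (simp add: stabilization_def)
  next
    case False
    then have len: "r \<le> length \<mu>"
      using r part_pos_iff[OF \<mu>, of r] by simp
    let ?ys = "take r \<mu> @ r # drop r \<mu>"
    have hi: "r \<le> x" if "x \<in> set (take r \<mu>)" for x
    proof -
      from that obtain i where i: "i < r" "x = \<mu> ! i"
        using len by (auto simp: in_set_conv_nth)
      then have "part \<mu> r \<le> part \<mu> (Suc i)"
        by (intro part_antimono \<mu>) auto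
      then show ?thesis
        using i len r by (simp add: part_Suc)
    qed
    have lo: "x \<le> r" if "x \<in> set (drop r \<mu>)" for x
    proof -
      from that obtain i where i: "r + i < length \<mu>" "x = \<mu> ! (r + i)"
        by (auto simp: in_set_conv_nth) (metis less_diff_conv add.commute)
      then have "part \<mu> (Suc (r + i)) \<le> part \<mu> (Suc r)"
        by (intro part_antimono \<mu>) auto
      then show ?thesis
        using i r by (simp add: part_Suc)
    qed
    have sorted\<mu>: "sorted_wrt (\<ge>) \<mu>"
      using \<mu> by (simp add: is_partition_def)
    have "sorted_wrt (\<ge>) ?ys"
      using hi lo sorted_wrt_take[OF sorted\<mu>] sorted_wrt_drop[OF sorted\<mu>]
      by (auto simp: sorted_wrt_append intro: order_trans)
    moreover have nz: "0 \<notin> set ?ys"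
      using \<mu> False by (auto simp: is_partition_def dest: in_set_takeD in_set_dropD)
    ultimately have ys: "is_partition ?ys"
      by (simp add: is_partition_def)
    have "\<alpha> = ?ys"
    proof (rule partition_eqI[OF \<alpha> ys])
      fix i :: nat assume i: "1 \<le> i"
      have "part ?ys i = (if i \<le> r then part \<mu> i else if i = Suc r then r else part \<mu> (i - 1))"
      proof -
        consider "i \<le> r" | "i = Suc r" | "Suc r < i" by linarith
        then show ?thesis
        proof cases
          \<comment> \<open>Writing i as r + k + 2 avoids truncated subtraction: past the inserted
            row, row i of \<open>?ys\<close> is row i - 1 of \<mu>.\<close>
          case 3
          then obtain k where "i = Suc (Suc (r + k))"
            using less_iff_Suc_add by auto
          then show ?thesis
            using len by (auto simp: part_Suc nth_append)
        qed (use i len in \<open>auto simp: Defs.part_def nth_append\<close>)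
      qed
      then show "part \<alpha> i = part ?ys i"
        using part[OF i] by simp
    qed
    moreover have "sort (\<mu> @ [r]) = rev ?ys"
    proof (rule properties_for_sort)
      have "mset (take r \<mu>) + mset (drop r \<mu>) = mset \<mu>"
        by (metis append_take_drop_id mset_append)
      then show "mset (rev ?ys) = mset (\<mu> @ [r])"
        by (simp add: union_commute)
      show "sorted (rev ?ys)"
        using ys unfolding is_partition_def sorted_wrt_rev by simp
    qed
    moreover have "filter (\<lambda>x. 0 < x) ?ys = ?ys"
      using nz by (intro filter_True ballI) (metis neq0_conv)
    ultimately show ?thesis
      by (simp add: stabilization_def rank)
  qed
qed

section \<open>Tableaux with one-row content\<close>

text \<open>The interlacing form of "no two boxes in one column". It treats the rows separately,
  which later allows one row to be changed alone.\<close>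

definition horizontal_strip :: "nat list \<Rightarrow> nat list \<Rightarrow> bool" where
  "horizontal_strip \<alpha> \<nu> \<longleftrightarrow> (\<forall>i\<ge>1. part \<alpha> (Suc i) \<le> part \<nu> i \<and> part \<nu> i \<le> part \<alpha> i)"

lemma mem_skew_shape:
  "(i, j) \<in> skew_shape \<alpha> \<nu> \<longleftrightarrow> 1 \<le> i \<and> part \<nu> i < j \<and> j \<le> part \<alpha> i"
  by (auto simp: skew_shape_def young_diagram_def)

lemma young_diagram_subset_iff:
  "young_diagram \<nu> \<subseteq> young_diagram \<alpha> \<longleftrightarrow> (\<forall>i\<ge>1. part \<nu> i \<le> part \<alpha> i)"
proof
  assume sub: "young_diagram \<nu> \<subseteq> young_diagram \<alpha>"
  show "\<forall>i\<ge>1. part \<nu> i \<le> part \<alpha> i"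
  proof (intro allI impI)
    fix i :: nat assume i: "1 \<le> i"
    show "part \<nu> i \<le> part \<alpha> i"
    proof (cases "part \<nu> i = 0")
      case False
      then have "(i, part \<nu> i) \<in> young_diagram \<nu>"
        using i by (simp add: young_diagram_def)
      with sub show ?thesis
        by (auto simp: young_diagram_def)
    qed simp
  qed
qed (force simp: young_diagram_def)

lemma card_skew_shape:
  assumes "young_diagram \<nu> \<subseteq> young_diagram \<alpha>"
  shows "card (skew_shape \<alpha> \<nu>) = sum_list \<alpha> - sum_list \<nu>"
  unfolding skew_shape_def
  by (simp add: card_Diff_subset assms finite_young_diagram card_young_diagram)

lemma finite_skew_shape: "finite (skew_shape \<alpha> \<nu>)"
  by (simp add: skew_shape_def finite_young_diagram)

text \<open>Boxes of column j in rows i < i' would give j \<le> \<alpha>(i') \<le> \<alpha>(i+1)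
  \<le> \<nu>(i) < j. Conversely, if \<nu>(i) < \<alpha>(i+1), then column \<alpha>(i+1) contains
  boxes in rows i and i + 1.\<close>

lemma horizontal_strip_iff_columns:
  assumes \<alpha>: "is_partition \<alpha>" and \<nu>: "is_partition \<nu>"
  shows "horizontal_strip \<alpha> \<nu> \<longleftrightarrow> young_diagram \<nu> \<subseteq> young_diagram \<alpha> \<and>
    \<not> (\<exists>i i' j. (i, j) \<in> skew_shape \<alpha> \<nu> \<and> (i', j) \<in> skew_shape \<alpha> \<nu> \<and> i < i')"
    (is "_ \<longleftrightarrow> ?sub \<and> \<not> ?col")
proof
  assume strip: "horizontal_strip \<alpha> \<nu>"
  then have ?sub
    by (simp add: young_diagram_subset_iff horizontal_strip_def)
  moreover have False if c: "(i, j) \<in> skew_shape \<alpha> \<nu>" "(i', j) \<in> skew_shape \<alpha> \<nu>" "i < i'" for i i' j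
  proof -
    have "part \<alpha> i' \<le> part \<alpha> (Suc i)"
      using c by (intro part_antimono \<alpha>) auto
    also have "\<dots> \<le> part \<nu> i"
      using strip c by (simp add: horizontal_strip_def mem_skew_shape)
    finally show False
      using c by (simp add: mem_skew_shape)
  qed
  ultimately show "?sub \<and> \<not> ?col"
    by blast
next
  assume R: "?sub \<and> \<not> ?col"
  have "part \<alpha> (Suc i) \<le> part \<nu> i" if i: "1 \<le> i" for i
  proof (rule ccontr)
    assume "\<not> ?thesis"
    moreover have "part \<nu> (Suc i) \<le> part \<nu> i" "part \<alpha> (Suc i) \<le> part \<alpha> i"
      using i by (auto intro!: part_antimono \<alpha> \<nu>)
    ultimately have "(i, part \<alpha> (Suc i)) \<in> skew_shape \<alpha> \<nu>" "(Suc i, part \<alpha> (Suc i)) \<in> skew_shape \<alpha> \<nu>"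
      using i by (auto simp: mem_skew_shape)
    then show False
      using R by blast
  qed
  then show "horizontal_strip \<alpha> \<nu>"
    using R by (simp add: horizontal_strip_def young_diagram_subset_iff)
qed

text \<open>All labels are 1, so strictness down columns says that no column has two boxes, while
  the row and lattice conditions become automatic. The subtraction is exact, since a horizontal
  strip entails containment of diagrams.\<close>

lemma LR_one_row_iff:
  assumes \<alpha>: "is_partition \<alpha>" and \<nu>: "is_partition \<nu>" and len: "length lam \<le> 1"
  shows "T \<in> LR \<alpha> \<nu> lam \<longleftrightarrow> horizontal_strip \<alpha> \<nu> \<and>
    part lam 1 = sum_list \<alpha> - sum_list \<nu> \<and> T = restrict (\<lambda>_. 1) (skew_shape \<alpha> \<nu>)"
proof
  assume T: "T \<in> LR \<alpha> \<nu> lam"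
  then have sub: "young_diagram \<nu> \<subseteq> young_diagram \<alpha>" and fil: "T \<in> skew_shape \<alpha> \<nu> \<rightarrow>\<^sub>E {1..}"
    and ss: "semistandard \<alpha> \<nu> T" and cont: "has_content \<alpha> \<nu> T lam"
    by (auto simp: LR_def skew_tableaux_def)
  have one: "T b = 1" if b: "b \<in> skew_shape \<alpha> \<nu>" for b
  proof (rule ccontr)
    assume "T b \<noteq> 1"
    \<comment> \<open>A label c \<ge> 2 would have to occur \<open>part lam c\<close> = 0
      times.\<close>
    then have "2 \<le> T b"
      using PiE_mem[OF fil b] by simp
    then have "card {b' \<in> skew_shape \<alpha> \<nu>. T b' = T b} = 0"
      using cont len by (auto simp: has_content_def part_eq_0)
    then have "{b' \<in> skew_shape \<alpha> \<nu>. T b' = T b} = {}"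
      using finite_skew_shape[of \<alpha> \<nu>] by simp
    then show False
      using b by blast
  qed
  then have "{b \<in> skew_shape \<alpha> \<nu>. T b = 1} = skew_shape \<alpha> \<nu>"
    by auto
  then have "part lam 1 = sum_list \<alpha> - sum_list \<nu>"
    using cont card_skew_shape[OF sub] unfolding has_content_def by force
  moreover have "T = restrict (\<lambda>_. 1) (skew_shape \<alpha> \<nu>)"
    by (rule PiE_ext[OF fil]) (simp_all add: one)
  moreover have "horizontal_strip \<alpha> \<nu>"
    unfolding horizontal_strip_iff_columns[OF \<alpha> \<nu>]
    using sub ss one unfolding semistandard_def by (metis less_irrefl)
  ultimately show "horizontal_strip \<alpha> \<nu> \<and> part lam 1 = sum_list \<alpha> - sum_list \<nu> \<and>
    T = restrict (\<lambda>_. 1) (skew_shape \<alpha> \<nu>)"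
    by blast
next
  assume R: "horizontal_strip \<alpha> \<nu> \<and> part lam 1 = sum_list \<alpha> - sum_list \<nu> \<and>
    T = restrict (\<lambda>_. 1) (skew_shape \<alpha> \<nu>)"
  then have one: "T b = 1" if "b \<in> skew_shape \<alpha> \<nu>" for b
    using that by simp
  have sub: "young_diagram \<nu> \<subseteq> young_diagram \<alpha>"
    and col: "\<not> (\<exists>i i' j. (i, j) \<in> skew_shape \<alpha> \<nu> \<and> (i', j) \<in> skew_shape \<alpha> \<nu> \<and> i < i')"
    using R horizontal_strip_iff_columns[OF \<alpha> \<nu>] by auto
  have "semistandard \<alpha> \<nu> T"
    unfolding semistandard_def using one col by (metis order_refl)
  moreover have "T \<in> skew_tableaux \<alpha> \<nu>"
    using R by (simp add: skew_tableaux_def)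
  moreover have "lattice_word (reverse_reading_word \<alpha> \<nu> T)"
  proof -
    have "set (reverse_reading_word \<alpha> \<nu> T) \<subseteq> {1}"
      by (auto simp: reverse_reading_word_def one mem_skew_shape simp del: upt_Suc)
    then have "i + 1 \<notin> set (take n (reverse_reading_word \<alpha> \<nu> T))" if "1 \<le> i" for i n
      using that set_take_subset[of n "reverse_reading_word \<alpha> \<nu> T"] by fastforce
    then show ?thesis
      unfolding lattice_word_def by (metis count_notin zero_le)
  qed
  moreover have "has_content \<alpha> \<nu> T lam"
    unfolding has_content_def
  proof (intro allI impI)
    fix c :: nat assume c: "1 \<le> c"
    show "card {b \<in> skew_shape \<alpha> \<nu>. T b = c} = part lam c"
    proof (cases "c = 1")
      case True
      then have "{b \<in> skew_shape \<alpha> \<nu>. T b = c} = skew_shape \<alpha> \<nu>"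
        using one by auto
      then show ?thesis
        using True R card_skew_shape[OF sub] by simp
    next
      case False
      then have "{b \<in> skew_shape \<alpha> \<nu>. T b = c} = {}"
        using one by auto
      then have "card {b \<in> skew_shape \<alpha> \<nu>. T b = c} = 0"
        by (simp only: card.empty)
      then show ?thesis
        using False c len by (simp add: part_eq_0)
    qed
  qed
  ultimately show "T \<in> LR \<alpha> \<nu> lam"
    using sub by (simp add: LR_def)
qed

text \<open>Transposing turns a horizontal strip into a vertical one: each row gains at most one
  box. Each inequality is tested on a suitable box and carried over by
  \<open>le_part_conj_part_iff\<close>; zero parts are split off because that equivalence needs
  positive indices.\<close>

lemma horizontal_strip_conj_part_iff:
  assumes \<beta>: "is_partition \<beta>" and \<nu>: "is_partition \<nu>"
  shows "horizontal_strip \<beta> (conj_part \<nu>) \<longleftrightarrow>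
    (\<forall>i\<ge>1. part \<nu> i \<le> part (conj_part \<beta>) i \<and> part (conj_part \<beta>) i \<le> Suc (part \<nu> i))"
    (is "?L \<longleftrightarrow> ?R")
proof
  assume L: ?L
  show ?R
  proof (intro allI impI conjI)
    fix i :: nat assume i: "1 \<le> i"
    show "part \<nu> i \<le> part (conj_part \<beta>) i"
    proof (cases "part \<nu> i = 0")
      case False
      then have "i \<le> part (conj_part \<nu>) (part \<nu> i)"
        using i by (subst le_part_conj_part_iff[OF \<nu>]) auto
      also have "\<dots> \<le> part \<beta> (part \<nu> i)"
        using L False by (simp add: horizontal_strip_def)
      finally show ?thesis
        using i False by (subst le_part_conj_part_iff[OF \<beta>]) auto
    qed simp
    show "part (conj_part \<beta>) i \<le> Suc (part \<nu> i)"
    proof (rule ccontr)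
      assume "\<not> ?thesis"
      \<comment> \<open>With m = \<open>part \<nu> i\<close>, box (i, m + 2) of the conjugate of
        \<beta> puts i below row m + 2 of \<beta>, and interlacing puts it below row m + 1 of the
        conjugate of \<nu>, which means m + 1 \<le> m.\<close>
      then have "Suc (Suc (part \<nu> i)) \<le> part (conj_part \<beta>) i"
        by simp
      then have "i \<le> part \<beta> (Suc (Suc (part \<nu> i)))"
        using i by (subst (asm) le_part_conj_part_iff[OF \<beta>]) auto
      also have "\<dots> \<le> part (conj_part \<nu>) (Suc (part \<nu> i))"
        using L by (simp add: horizontal_strip_def)
      finally show False
        using i by (subst (asm) le_part_conj_part_iff[OF \<nu>]) auto
    qed
  qed
next
  assume R: ?R
  show ?L
    unfolding horizontal_strip_def
  proof (intro allI impI conjI)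
    fix j :: nat assume j: "1 \<le> j"
    show "part \<beta> (Suc j) \<le> part (conj_part \<nu>) j"
    proof (cases "part \<beta> (Suc j) = 0")
      case False
      then have "Suc j \<le> part (conj_part \<beta>) (part \<beta> (Suc j))"
        by (subst le_part_conj_part_iff[OF \<beta>]) auto
      also have "\<dots> \<le> Suc (part \<nu> (part \<beta> (Suc j)))"
        using R False by simp
      finally show ?thesis
        using j False by (subst le_part_conj_part_iff[OF \<nu>]) auto
    qed simp
    show "part (conj_part \<nu>) j \<le> part \<beta> j"
    proof (cases "part (conj_part \<nu>) j = 0")
      case False
      let ?i = "part (conj_part \<nu>) j"
      have "j \<le> part \<nu> ?i"
        using j False by (subst le_part_conj_part_iff[OF \<nu>, symmetric]) auto
      also have "\<dots> \<le> part (conj_part \<beta>) ?i"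
        using R False by simp
      finally show ?thesis
        using j False by (subst (asm) le_part_conj_part_iff[OF \<beta>]) auto
    qed simp
  qed
qed

section \<open>The one-row union, parametrized by partitions\<close>

definition strip_partitions :: "nat list \<Rightarrow> nat list \<Rightarrow> nat list set" where
  "strip_partitions \<alpha> \<gamma> = {\<nu>. is_partition \<nu> \<and> (\<forall>i\<ge>1.
     part \<alpha> (Suc i) \<le> part \<nu> i \<and> part \<nu> i \<le> part \<alpha> i \<and>
     part \<nu> i \<le> part \<gamma> i \<and> part \<gamma> i \<le> Suc (part \<nu> i))}"

text \<open>The only element of the union over \<nu>, with both tableaux filled by 1. The filter
  turns content 0 into the empty partition.\<close>

definition strip_pair ::
    "nat list \<Rightarrow> nat list \<Rightarrow> nat list \<Rightarrow> (nat list \<times> nat list) \<times> LR_pair" where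
  "strip_pair \<alpha> \<beta> \<nu> =
     ((filter (\<lambda>x. 0 < x) [sum_list \<alpha> - sum_list \<nu>], \<nu>),
      (restrict (\<lambda>_. 1) (skew_shape \<alpha> \<nu>), restrict (\<lambda>_. 1) (skew_shape \<beta> (conj_part \<nu>))))"

text \<open>Conjugation preserves size and \<alpha>, \<beta> have equal size, so both skew shapes
  have equally many boxes and one content serves both tableaux.\<close>

lemma X_union_1_eq:
  assumes \<alpha>: "is_partition \<alpha>" and \<beta>: "is_partition \<beta>" and sum: "sum_list \<alpha> = sum_list \<beta>"
  shows "X_union \<alpha> \<beta> 1 = strip_pair \<alpha> \<beta> ` strip_partitions \<alpha> (conj_part \<beta>)"
proof -
  have mem: "\<nu> \<in> strip_partitions \<alpha> (conj_part \<beta>) \<longleftrightarrow>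
      is_partition \<nu> \<and> horizontal_strip \<alpha> \<nu> \<and> horizontal_strip \<beta> (conj_part \<nu>)" for \<nu>
  proof (cases "is_partition \<nu>")
    case True
    show ?thesis
      unfolding horizontal_strip_conj_part_iff[OF \<beta> True]
      unfolding strip_partitions_def horizontal_strip_def by blast
  qed (simp add: strip_partitions_def)
  have row: "is_partition lam \<and> length lam \<le> 1 \<and> part lam 1 = m \<longleftrightarrow>
      lam = filter (\<lambda>x. 0 < x) [m]" for lam m
    by (cases lam) (auto simp: is_partition_def part_Cons)
  have "((lam, \<nu>), T, U) \<in> X_union \<alpha> \<beta> 1 \<longleftrightarrow>
      \<nu> \<in> strip_partitions \<alpha> (conj_part \<beta>) \<and> ((lam, \<nu>), T, U) = strip_pair \<alpha> \<beta> \<nu>" for lam \<nu> T U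
  proof (cases "is_partition lam \<and> is_partition \<nu> \<and> length lam \<le> 1")
    case True
    then have "((lam, \<nu>), T, U) \<in> X_union \<alpha> \<beta> 1 \<longleftrightarrow>
        T \<in> LR \<alpha> \<nu> lam \<and> U \<in> LR \<beta> (conj_part \<nu>) lam"
      by (simp add: X_union_def X_pairs_def)
    also have "\<dots> \<longleftrightarrow> \<nu> \<in> strip_partitions \<alpha> (conj_part \<beta>) \<and> ((lam, \<nu>), T, U) = strip_pair \<alpha> \<beta> \<nu>"
      using True row[of lam "sum_list \<alpha> - sum_list \<nu>"] unfolding mem strip_pair_def
      by (auto simp: LR_one_row_iff \<alpha> \<beta> is_partition_conj_part sum_list_conj_part sum)
    finally show ?thesis .
  next
    case False
    then have "((lam, \<nu>), T, U) \<notin> X_union \<alpha> \<beta> 1"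
      by (auto simp: X_union_def)
    moreover have "is_partition \<nu> \<Longrightarrow> lam \<noteq> filter (\<lambda>x. 0 < x) [sum_list \<alpha> - sum_list \<nu>]"
      using False row by blast
    ultimately show ?thesis
      unfolding mem strip_pair_def by blast
  qed
  note iff = this
  show ?thesis
  proof (intro set_eqI)
    fix \<chi> :: "(nat list \<times> nat list) \<times> LR_pair"
    obtain lam \<nu> T U where \<chi>: "\<chi> = ((lam, \<nu>), T, U)"
      by (metis prod.exhaust)
    \<comment> \<open>The tag records \<nu>, so \<open>strip_pair\<close> is injective.\<close>
    have "\<nu>' = \<nu>" if "((lam, \<nu>), T, U) = strip_pair \<alpha> \<beta> \<nu>'" for \<nu>'
      using that by (simp add: strip_pair_def)
    then show "\<chi> \<in> X_union \<alpha> \<beta> 1 \<longleftrightarrow> \<chi> \<in> strip_pair \<alpha> \<beta> ` strip_partitions \<alpha> (conj_part \<beta>)"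
      unfolding \<chi> iff by blast
  qed
qed

section \<open>The involution\<close>

lemma X_sign_strip_pair: "X_sign (strip_pair \<alpha> \<beta> \<nu>) = (-1) ^ sum_list \<nu>"
  by (simp add: X_sign_def strip_pair_def)

text \<open>Row k admits exactly the values \<gamma>(k) - 1 and \<gamma>(k), and the formula swaps
  them.\<close>

lemma ex_toggle_row:
  assumes \<alpha>: "is_partition \<alpha>" and \<nu>: "\<nu> \<in> strip_partitions \<alpha> \<gamma>"
    and k: "1 \<le> k" "part \<alpha> (Suc k) < part \<gamma> k" "part \<gamma> k \<le> part \<alpha> k"
  shows "\<exists>\<nu>' \<in> strip_partitions \<alpha> \<gamma>.
    \<forall>i\<ge>1. part \<nu>' i = (if i = k then 2 * part \<gamma> k - 1 - part \<nu> k else part \<nu> i)"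
proof -
  define f where "f i = (if i = k then 2 * part \<gamma> k - 1 - part \<nu> k else part \<nu> i)" for i
  have f: "part \<alpha> (Suc i) \<le> f i \<and> f i \<le> part \<alpha> i \<and> f i \<le> part \<gamma> i \<and> part \<gamma> i \<le> Suc (f i)"
    if "1 \<le> i" for i
  proof (cases "i = k")
    case True
    have "part \<nu> k \<le> part \<gamma> k" "part \<gamma> k \<le> Suc (part \<nu> k)"
      using \<nu> k by (auto simp: strip_partitions_def)
    then show ?thesis
      using True k by (auto simp: f_def)
  next
    case False
    then show ?thesis
      using \<nu> that by (simp add: f_def strip_partitions_def)
  qed
  \<comment> \<open>Interlacing with \<alpha> alone makes the toggled rows decrease, whatever
    happens in row k.\<close>
  have "f j \<le> f i" if "1 \<le> i" "i \<le> j" for i j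
  proof (cases "i = j")
    case False
    have "f j \<le> part \<alpha> j"
      using f that by force
    also have "\<dots> \<le> part \<alpha> (Suc i)"
      using False that by (intro part_antimono \<alpha>) auto
    also have "\<dots> \<le> f i"
      using f that by force
    finally show ?thesis .
  qed simp
  moreover have "f i = 0" if "length \<alpha> < i" for i
    using f[of i] that by (simp add: part_eq_0)
  ultimately obtain \<nu>' where "is_partition \<nu>'" "\<forall>i\<ge>1. part \<nu>' i = f i"
    using ex_partition_part[of f "length \<alpha>"] by blast
  then show ?thesis
    using f unfolding f_def[symmetric] by (intro bexI[of _ \<nu>']) (auto simp: strip_partitions_def)
qed

text \<open>The conditions on k involve only \<alpha> and \<gamma>, so the same row is toggled for
  every \<nu>; hence toggling twice restores \<nu>, and each toggle changes the size by one.\<close>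

lemma strip_partitions_involution:
  assumes \<alpha>: "is_partition \<alpha>"
    and k: "1 \<le> k" "part \<alpha> (Suc k) < part \<gamma> k" "part \<gamma> k \<le> part \<alpha> k"
  obtains t where "\<And>\<nu>. \<nu> \<in> strip_partitions \<alpha> \<gamma> \<Longrightarrow> t \<nu> \<in> strip_partitions \<alpha> \<gamma>"
    and "\<And>\<nu>. \<nu> \<in> strip_partitions \<alpha> \<gamma> \<Longrightarrow> t (t \<nu>) = \<nu>"
    and "\<And>\<nu>. \<nu> \<in> strip_partitions \<alpha> \<gamma> \<Longrightarrow> even (sum_list (t \<nu>)) \<longleftrightarrow> odd (sum_list \<nu>)"
proof -
  have "\<exists>t. \<forall>\<nu>\<in>strip_partitions \<alpha> \<gamma>. t \<nu> \<in> strip_partitions \<alpha> \<gamma> \<and>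
    (\<forall>i\<ge>1. part (t \<nu>) i = (if i = k then 2 * part \<gamma> k - 1 - part \<nu> k else part \<nu> i))"
    using ex_toggle_row[OF \<alpha> _ k] by (intro bchoice ballI) blast
  then obtain t where t: "\<And>\<nu>. \<nu> \<in> strip_partitions \<alpha> \<gamma> \<Longrightarrow> t \<nu> \<in> strip_partitions \<alpha> \<gamma>"
    and part: "\<And>\<nu> i. \<nu> \<in> strip_partitions \<alpha> \<gamma> \<Longrightarrow> 1 \<le> i \<Longrightarrow>
      part (t \<nu>) i = (if i = k then 2 * part \<gamma> k - 1 - part \<nu> k else part \<nu> i)"
    by blast
  have range: "part \<nu> k \<le> part \<gamma> k" "part \<gamma> k \<le> Suc (part \<nu> k)"
    if "\<nu> \<in> strip_partitions \<alpha> \<gamma>" for \<nu>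
    using that k by (auto simp: strip_partitions_def)
  have "t (t \<nu>) = \<nu>" if \<nu>: "\<nu> \<in> strip_partitions \<alpha> \<gamma>" for \<nu>
  proof (rule partition_eqI)
    show "is_partition (t (t \<nu>))" "is_partition \<nu>"
      using t[OF t[OF \<nu>]] \<nu> by (auto simp: strip_partitions_def)
    show "part (t (t \<nu>)) i = part \<nu> i" if "1 \<le> i" for i
      using range[OF \<nu>] k that by (auto simp: part[OF t[OF \<nu>]] part[OF \<nu>])
  qed
  moreover have "even (sum_list (t \<nu>)) \<longleftrightarrow> odd (sum_list \<nu>)"
    if \<nu>: "\<nu> \<in> strip_partitions \<alpha> \<gamma>" for \<nu>
  proof -
    \<comment> \<open>Large enough to cover row k and all rows of both partitions.\<close>
    define N where "N = k + length \<nu> + length (t \<nu>)"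
    have split: "sum_list \<kappa> = part \<kappa> k + (\<Sum>i\<in>{1..N} - {k}. part \<kappa> i)" if "length \<kappa> \<le> N" for \<kappa>
      using that k sum.remove[of "{1..N}" k "part \<kappa>"] by (simp add: sum_part[symmetric] N_def)
    have "(\<Sum>i\<in>{1..N} - {k}. part (t \<nu>) i) = (\<Sum>i\<in>{1..N} - {k}. part \<nu> i)"
      by (intro sum.cong) (auto simp: part[OF \<nu>])
    then have "sum_list (t \<nu>) + part \<nu> k = sum_list \<nu> + part (t \<nu>) k"
      using split[of \<nu>] split[of "t \<nu>"] by (simp add: N_def)
    \<comment> \<open>The two values of row k add up to an odd number, so they differ in
      parity.\<close>
    moreover have "part (t \<nu>) k + part \<nu> k = 2 * part \<gamma> k - 1"
      using range[OF \<nu>] k by (simp add: part[OF \<nu>])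
    then have "odd (part (t \<nu>) k + part \<nu> k)"
      using k by simp
    ultimately show ?thesis
      by (metis even_add)
  qed
  ultimately show ?thesis
    using t that by blast
qed

section \<open>The exceptional case\<close>

text \<open>If row n is of the first kind and row n + 1 of the second, then \<gamma>(n+1) =
  \<alpha>(n+1) + 1 > \<gamma>(n), which is impossible. So the rows of the second kind form an
  initial segment.\<close>

lemma ex_crossover:
  assumes \<alpha>: "is_partition \<alpha>" and \<gamma>: "is_partition \<gamma>"
    and alt: "\<And>i. 1 \<le> i \<Longrightarrow> part \<gamma> i = part \<alpha> (Suc i) \<or> part \<gamma> i = Suc (part \<alpha> i)"
  shows "\<exists>r. (\<forall>i. 1 \<le> i \<and> i \<le> r \<longrightarrow> part \<gamma> i = Suc (part \<alpha> i)) \<and>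
    (\<forall>i>r. part \<gamma> i = part \<alpha> (Suc i))"
proof -
  \<comment> \<open>Counting 0 as a solution makes r = 0 when no row is of the second kind;
    solutions are bounded because such rows of \<gamma> are nonempty.\<close>
  define P where "P i \<longleftrightarrow> i = 0 \<or> part \<gamma> i = Suc (part \<alpha> i)" for i
  define r where "r = (GREATEST i. P i)"
  have bound: "i \<le> length \<gamma>" if "P i" for i
    using that part_pos_iff[OF \<gamma>, of i] by (auto simp: P_def)
  have "P 0"
    by (simp add: P_def)
  then have r: "P r" and max: "\<And>i. P i \<Longrightarrow> i \<le> r"
    unfolding r_def using bound by (blast intro: GreatestI_nat Greatest_le_nat)+
  have "P i" if "i \<le> r" for i
    using that r
  proof (induction rule: inc_induct)
    case (step n)
    show ?case
    proof (rule ccontr)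
      assume "\<not> P n"
      then have n: "1 \<le> n" "part \<gamma> n = part \<alpha> (Suc n)"
        using alt[of n] by (auto simp: P_def)
      moreover have "part \<gamma> (Suc n) = Suc (part \<alpha> (Suc n))"
        using step by (simp add: P_def)
      ultimately show False
        using part_antimono[OF \<gamma>, of n "Suc n"] by simp
    qed
  qed auto
  moreover have "part \<gamma> i = part \<alpha> (Suc i)" if "r < i" for i
    using alt[of i] max[of i] that by (auto simp: P_def)
  ultimately show ?thesis
    by (intro exI[of _ r]) (auto simp: P_def)
qed

text \<open>The first r rows of \<gamma> exceed those of \<alpha> by r boxes in total, and the
  remaining rows of \<gamma> are those of \<alpha> with row r + 1 left out. Equal sizes make that
  row compensate the excess.\<close>

lemma crossover_part_eq:
  assumes sum: "sum_list \<alpha> = sum_list \<gamma>"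
    and hi: "\<And>i. 1 \<le> i \<Longrightarrow> i \<le> r \<Longrightarrow> part \<gamma> i = Suc (part \<alpha> i)"
    and lo: "\<And>i. r < i \<Longrightarrow> part \<gamma> i = part \<alpha> (Suc i)"
  shows "part \<alpha> (Suc r) = r"
proof -
  define M where "M = length \<alpha> + length \<gamma>"
  have split: "(\<Sum>i=1..r + n. f i) = (\<Sum>i=1..r. f i) + (\<Sum>i=Suc r..r + n. f i)"
    for f :: "nat \<Rightarrow> nat" and n
    using sum.ub_add_nat[of 1 r f n] by simp
  have "sum_list \<gamma> = (\<Sum>i=1..r + M. part \<gamma> i)"
    by (rule sum_part[symmetric]) (simp add: M_def)
  also have "\<dots> = (\<Sum>i=1..r. Suc (part \<alpha> i)) + (\<Sum>i=Suc r..r + M. part \<alpha> (Suc i))"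
    unfolding split using hi lo by (intro arg_cong2[of _ _ _ _ "(+)"] sum.cong) auto
  also have "\<dots> = r + (\<Sum>i=1..r. part \<alpha> i) + (\<Sum>i=Suc (Suc r)..Suc (r + M). part \<alpha> i)"
    by (simp add: sum.shift_bounds_cl_Suc_ivl[symmetric] sum_Suc)
  finally have "sum_list \<gamma> = r + (\<Sum>i=1..r. part \<alpha> i) + (\<Sum>i=Suc (Suc r)..Suc (r + M). part \<alpha> i)" .
  moreover have "sum_list \<alpha> = (\<Sum>i=1..r + Suc M. part \<alpha> i)"
    by (rule sum_part[symmetric]) (simp add: M_def)
  then have "sum_list \<alpha> = (\<Sum>i=1..r. part \<alpha> i) + part \<alpha> (Suc r) +
      (\<Sum>i=Suc (Suc r)..Suc (r + M). part \<alpha> i)"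
    unfolding split by (simp add: sum.atLeast_Suc_atMost)
  ultimately show ?thesis
    using sum by simp
qed

lemma ex_stabilization:
  assumes \<alpha>: "is_partition \<alpha>" and \<beta>: "is_partition \<beta>" and sum: "sum_list \<alpha> = sum_list \<beta>"
    and alt: "\<And>i. 1 \<le> i \<Longrightarrow>
      part (conj_part \<beta>) i = part \<alpha> (Suc i) \<or> part (conj_part \<beta>) i = Suc (part \<alpha> i)"
  shows "\<exists>\<mu>. is_partition \<mu> \<and> \<alpha> = stabilization 1 \<mu> \<and> \<beta> = stabilization 1 (conj_part \<mu>)"
proof -
  obtain r where hi: "\<And>i. 1 \<le> i \<Longrightarrow> i \<le> r \<Longrightarrow> part (conj_part \<beta>) i = Suc (part \<alpha> i)"
    and lo: "\<And>i. r < i \<Longrightarrow> part (conj_part \<beta>) i = part \<alpha> (Suc i)"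
    using ex_crossover[OF \<alpha> is_partition_conj_part[OF \<beta>] alt] by blast
  have r: "part \<alpha> (Suc r) = r"
    using crossover_part_eq[OF _ hi lo] sum sum_list_conj_part[OF \<beta>] by simp
  \<comment> \<open>The rows of \<alpha> with row r + 1, of length r, removed.\<close>
  define f where "f i = (if i \<le> r then part \<alpha> i else part \<alpha> (Suc i))" for i
  have "f j \<le> f i" if "1 \<le> i" "i \<le> j" for i j
    using that by (auto simp: f_def intro!: part_antimono \<alpha>)
  moreover have "f i = 0" if "length \<alpha> < i" for i
    using that by (simp add: f_def part_eq_0)
  ultimately obtain \<mu> where \<mu>: "is_partition \<mu>" and part\<mu>: "\<And>i. 1 \<le> i \<Longrightarrow> part \<mu> i = f i"
    using ex_partition_part[of f "length \<alpha>"] by blast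
  note \<mu>' = is_partition_conj_part[OF \<mu>]
  note conj = le_part_conj_part_iff[OF \<mu>]
  have \<mu>_hi: "r \<le> part \<mu> i" if "1 \<le> i" "i \<le> r" for i
    using that part_antimono[OF \<alpha>, of i "Suc r"] r by (simp add: part\<mu> f_def)
  have \<mu>_lo: "part \<mu> i \<le> r" if "r < i" for i
    using that part_antimono[OF \<alpha>, of "Suc r" "Suc i"] r by (simp add: part\<mu> f_def)
  have "\<alpha> = stabilization 1 \<mu>"
  proof (rule stabilization_1_eqI[OF \<alpha> \<mu>])
    show "r \<le> part \<mu> r"
      using \<mu>_hi[of r] by (cases "r = 0") auto
  qed (use \<mu>_lo r in \<open>auto simp: part\<mu> f_def\<close>)
  moreover have "\<beta> = stabilization 1 (conj_part \<mu>)"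
  proof (rule stabilization_1_eqI[OF \<beta> \<mu>'])
    \<comment> \<open>The Durfee square is symmetric: box (r, r) lies in \<mu> if r > 0, and box (r
      + 1, r + 1) does not.\<close>
    show "r \<le> part (conj_part \<mu>) r"
      using \<mu>_hi[of r] conj[of r r] by (cases "r = 0") auto
    show "part (conj_part \<mu>) (Suc r) \<le> r"
      using \<mu>_lo[of "Suc r"] conj[of "Suc r" "Suc r"] by auto
    fix j :: nat assume j: "1 \<le> j"
    have "i \<le> part \<beta> j \<longleftrightarrow> i \<le> (if j \<le> r then part (conj_part \<mu>) j else if j = Suc r then r
        else part (conj_part \<mu>) (j - 1))" if i: "1 \<le> i" for i
    proof -
      have "i \<le> part \<beta> j \<longleftrightarrow> j \<le> part (conj_part \<beta>) i"
        using le_part_conj_part_iff[OF \<beta> j i] by simp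
      \<comment> \<open>The conjugate of \<beta> is \<mu> with one box added to each of the first r
        rows, that is, with a new column r + 1 of length r; transposed, this is the new row of
        \<beta>.\<close>
      moreover have "part (conj_part \<beta>) i = (if i \<le> r then Suc (part \<mu> i) else part \<mu> i)"
        using i hi lo by (simp add: part\<mu> f_def)
      ultimately show ?thesis
        using \<mu>_hi[OF i] \<mu>_lo[of i] conj[OF i j] conj[of i "j - 1"] i j
        by (auto split: if_splits)
    qed
    then show "part \<beta> j = (if j \<le> r then part (conj_part \<mu>) j
        else if j = Suc r then r else part (conj_part \<mu>) (j - 1))"
      by (rule nat_eqI_lower_bounds)
  qed
  ultimately show ?thesis
    using \<mu> by blast
qed

theorem theorem4p9:
  fixes \<alpha> \<beta> :: "nat list"
  assumes "is_partition \<alpha>" and "is_partition \<beta>"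
    and "sum_list \<alpha> = sum_list \<beta>"
    and "\<not> (\<exists>\<mu>. is_partition \<mu> \<and> \<alpha> = stabilization 1 \<mu> \<and> \<beta> = stabilization 1 (conj_part \<mu>))"
  shows "\<exists>\<phi>. \<phi> \<in> X_union \<alpha> \<beta> 1 \<rightarrow> X_union \<alpha> \<beta> 1 \<and>
           (\<forall>\<chi> \<in> X_union \<alpha> \<beta> 1. \<phi> (\<phi> \<chi>) = \<chi> \<and> X_sign (\<phi> \<chi>) = - X_sign \<chi>)"
proof -
  let ?\<gamma> = "conj_part \<beta>"
  let ?S = "strip_partitions \<alpha> ?\<gamma>"
  note X = X_union_1_eq[OF assms(1-3)]
  show ?thesis
  proof (cases "\<exists>k\<ge>1. part \<alpha> (Suc k) < part ?\<gamma> k \<and> part ?\<gamma> k \<le> part \<alpha> k")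
    case True
    then obtain k where k: "1 \<le> k" "part \<alpha> (Suc k) < part ?\<gamma> k" "part ?\<gamma> k \<le> part \<alpha> k"
      by blast
    from strip_partitions_involution[OF assms(1) k] obtain t where t: "\<And>\<nu>. \<nu> \<in> ?S \<Longrightarrow> t \<nu> \<in> ?S" "\<And>\<nu>. \<nu> \<in> ?S \<Longrightarrow> t (t \<nu>) = \<nu>"
      "\<And>\<nu>. \<nu> \<in> ?S \<Longrightarrow> even (sum_list (t \<nu>)) \<longleftrightarrow> odd (sum_list \<nu>)"
      by blast
    \<comment> \<open>The tag determines the whole element, so toggling its \<nu> and rebuilding the
      pair suffices.\<close>
    define \<phi> where "\<phi> \<chi> = strip_pair \<alpha> \<beta> (t (snd (fst \<chi>)))" for \<chi> :: "(nat list \<times> nat list) \<times> LR_pair"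
    have \<phi>: "\<phi> (strip_pair \<alpha> \<beta> \<nu>) = strip_pair \<alpha> \<beta> (t \<nu>)" for \<nu>
      by (simp add: \<phi>_def strip_pair_def)
    have "X_sign (strip_pair \<alpha> \<beta> (t \<nu>)) = - X_sign (strip_pair \<alpha> \<beta> \<nu>)" if "\<nu> \<in> ?S" for \<nu>
      using t(3)[OF that] by (cases "even (sum_list \<nu>)") (simp_all add: X_sign_strip_pair)
    then show ?thesis
      unfolding X by (intro exI[of _ \<phi>]) (auto simp: \<phi> t)
  next
    case False
    \<comment> \<open>A member \<nu> would give \<alpha>(i+1) \<le> \<gamma>(i) \<le> \<alpha>(i) +
      1 in every row; as no row has two admissible values, \<gamma>(i) is one of these two bounds,
      which is the excluded case.\<close>
    have "?S = {}"
    proof (rule ccontr)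
      assume "?S \<noteq> {}"
      then obtain \<nu> where "\<nu> \<in> ?S" by blast
      then have "part \<alpha> (Suc i) \<le> part ?\<gamma> i \<and> part ?\<gamma> i \<le> Suc (part \<alpha> i)" if "1 \<le> i" for i
        using that by (auto simp: strip_partitions_def intro: order_trans)
      then have "part ?\<gamma> i = part \<alpha> (Suc i) \<or> part ?\<gamma> i = Suc (part \<alpha> i)" if "1 \<le> i" for i
        using that False by (meson le_antisym not_less not_less_eq_eq)
      then show False
        using ex_stabilization[OF assms(1-3)] assms(4) by blast
    qed
    then show ?thesis
      unfolding X by simp
  qed
qed

end
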